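(* In the isometry group of the 2-sphere $S^2=\{x\in\mathbb{R}^3: |x|=1\}$, any relation among reflections in great circles follows from the pencil relations and the involution relations. That is, if $l_1,\dots,l_n$ are great circles with $R_{l_1}\circ R_{l_2}\circ\dots\circ R_{l_n}=\mathrm{id}$, then this relation is a consequence of pencil relations and involution relations.
   Context: For a great circle $l\subset S^2$, $R_l:S^2\to S^2$ denotes the reflection in $l$, i.e. the restriction to $S^2$ of the orthogonal reflection of $\mathbb{R}^3$ in the 2-dimensional vector subspace containing $l$. A pencil relation is an equality $R_m\circ R_l=R_{m'}\circ R_{l'}$ that holds in the isometry group, where $l,m,l',m'$ are great circles such that $l\cap m=l'\cap m'$ and the angles between the great circles satisfy $\measuredangle(l,m)=\measuredangle(l',m')$ and $\measuredangle(l,l')=\measuredangle(m,m')$. An involution relation is an equality $R_l^2=\mathrm{id}$, where $l$ is a great circle. A relation $R_{l_1}\circ\dots\circ R_{l_n}=\mathrm{id}$ follows from (is a consequence of) the pencil and involution relations if, in the free group on the set of symbols $\{r_l\}$ indexed by all great circles $l$, the word $r_{l_1}r_{l_2}\cdots r_{l_n}$ lies in the normal closure of the set of all elements $r_l^2$ and all elements $r_m r_l (r_{m'}r_{l'})^{-1}$ corresponding to involution and pencil relations. *)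

theory Defs
  imports "HOL-Analysis.Analysis" "HOL-Algebra.Bij" "HOL-Algebra.Coset"
begin

section \<open>Free groups and normal closures\<close>

text \<open>A letter \<open>(True, s)\<close> stands for the generator \<open>s\<close>, and \<open>(False, s)\<close> for its formal inverse.
  The free group consists of the reduced words; \<open>cancel_cons x w\<close> is the reduced form
  of \<open>x # w\<close> if \<open>w\<close> is reduced, so that the product below is the
  reduced form of the concatenation.\<close>

definition letter_inv :: "bool \<times> 's \<Rightarrow> bool \<times> 's" where
  "letter_inv x = (\<not> fst x, snd x)"

definition reduced_word :: "(bool \<times> 's) list \<Rightarrow> bool" where
  "reduced_word w \<longleftrightarrow> successively (\<lambda>x y. y \<noteq> letter_inv x) w"

definition cancel_cons :: "bool \<times> 's \<Rightarrow> (bool \<times> 's) list \<Rightarrow> (bool \<times> 's) list" where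
  "cancel_cons x w =
     (case w of [] \<Rightarrow> [x] | y # ys \<Rightarrow> if y = letter_inv x then ys else x # w)"

definition free_group :: "'s set \<Rightarrow> (bool \<times> 's) list monoid" where
  "free_group S =
     \<lparr>carrier = {w. set w \<subseteq> UNIV \<times> S \<and> reduced_word w},
      mult = (\<lambda>v w. foldr cancel_cons v w),
      one = []\<rparr>"

definition free_gen :: "'s \<Rightarrow> (bool \<times> 's) list" where
  "free_gen s = [(True, s)]"

definition normal_closure :: "('a, 'b) monoid_scheme \<Rightarrow> 'a set \<Rightarrow> 'a set" where
  "normal_closure G A = \<Inter>{N. N \<lhd> G \<and> A \<subseteq> N}"

lemma letter_inv_inv [simp]: "letter_inv (letter_inv x) = x"
  by (simp add: letter_inv_def)

lemma letter_inv_neq [simp]: "letter_inv x \<noteq> x" "x \<noteq> letter_inv x"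
  by (auto simp: letter_inv_def prod_eq_iff)

lemma reduced_Nil [simp]: "reduced_word []"
  by (simp add: reduced_word_def)

lemma reduced_ConsD: "reduced_word (x # w) \<Longrightarrow> reduced_word w"
  by (cases w) (auto simp: reduced_word_def)

lemma reduced_cancel_cons: "reduced_word w \<Longrightarrow> reduced_word (cancel_cons x w)"
  by (cases w) (auto simp: cancel_cons_def reduced_word_def dest: reduced_ConsD[unfolded reduced_word_def])

lemma reduced_foldr: "reduced_word w \<Longrightarrow> reduced_word (foldr cancel_cons v w)"
  by (induction v) (auto intro: reduced_cancel_cons)

lemma set_cancel_cons: "set (cancel_cons x w) \<subseteq> insert x (set w)"
  by (cases w) (auto simp: cancel_cons_def)

lemma set_foldr: "set (foldr cancel_cons v w) \<subseteq> set v \<union> set w"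
proof (induction v)
  case (Cons x v)
  then show ?case
    using set_cancel_cons[of x "foldr cancel_cons v w"] by auto
qed simp

lemma cancel_cons_letter_inv:
  "reduced_word w \<Longrightarrow> cancel_cons (letter_inv x) (cancel_cons x w) = w"
  by (cases w; cases "tl w") (auto simp: cancel_cons_def reduced_word_def)

lemma cancel_cons_reduced: "reduced_word (x # w) \<Longrightarrow> cancel_cons x w = x # w"
  by (cases w) (auto simp: cancel_cons_def reduced_word_def)

lemma foldr_cancel_Nil: "reduced_word w \<Longrightarrow> foldr cancel_cons w [] = w"
proof (induction w)
  case (Cons x w)
  then show ?case
    using reduced_ConsD[of x w] by (simp add: cancel_cons_reduced)
qed simp

lemma foldr_cancel_cons:
  assumes "reduced_word z"
  shows "foldr cancel_cons (cancel_cons x w) z = cancel_cons x (foldr cancel_cons w z)"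
proof (cases w)
  case (Cons y ys)
  have "cancel_cons x (cancel_cons (letter_inv x) (foldr cancel_cons ys z)) = foldr cancel_cons ys z"
    using cancel_cons_letter_inv[of _ "letter_inv x"] assms by (simp add: reduced_foldr)
  then show ?thesis
    by (simp add: Cons cancel_cons_def[of x "y # ys"])
qed (simp add: cancel_cons_def)

lemma foldr_cancel_assoc:
  assumes "reduced_word z"
  shows "foldr cancel_cons (foldr cancel_cons v w) z = foldr cancel_cons v (foldr cancel_cons w z)"
  by (induction v) (auto simp: foldr_cancel_cons assms)

lemma foldr_cancel_inverse:
  "foldr cancel_cons (map letter_inv (rev w)) w = []"
proof (induction w)
  case (Cons x w)
  then show ?case
    by (simp add: cancel_cons_def[of "letter_inv x"])
qed simp

lemma reduced_inverse: "reduced_word w \<Longrightarrow> reduced_word (map letter_inv (rev w))"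
  unfolding reduced_word_def successively_map successively_rev
  by (erule successively_mono) (auto simp: letter_inv_def)

lemma group_free_group: "group (free_group S)"
proof (rule groupI)
  fix w assume "w \<in> carrier (free_group S)"
  then show "\<exists>v\<in>carrier (free_group S). v \<otimes>\<^bsub>free_group S\<^esub> w = \<one>\<^bsub>free_group S\<^esub>"
    by (intro bexI[of _ "map letter_inv (rev w)"])
       (auto simp: free_group_def foldr_cancel_inverse reduced_inverse letter_inv_def)
next
  fix v w assume "v \<in> carrier (free_group S)" "w \<in> carrier (free_group S)"
  then show "v \<otimes>\<^bsub>free_group S\<^esub> w \<in> carrier (free_group S)"
    using set_foldr[of v w] by (auto simp: free_group_def reduced_foldr)
qed (auto simp: free_group_def foldr_cancel_assoc)

lemma free_gen_in_carrier: "s \<in> S \<Longrightarrow> free_gen s \<in> carrier (free_group S)"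
  by (simp add: free_gen_def free_group_def reduced_word_def)


section \<open>The isometry group of a subset of a metric space\<close>

definition isometry_group :: "'a::metric_space set \<Rightarrow> ('a \<Rightarrow> 'a) monoid" where
  "isometry_group X =
     (BijGroup X)\<lparr>carrier := {f \<in> Bij X. \<forall>x\<in>X. \<forall>y\<in>X. dist (f x) (f y) = dist x y}\<rparr>"

lemma group_isometry_group: "group (isometry_group X)"
proof -
  let ?H = "{f \<in> Bij X. \<forall>x\<in>X. \<forall>y\<in>X. dist (f x) (f y) = dist x y}"
  interpret B: group "BijGroup X" by (rule group_BijGroup)
  have "subgroup ?H (BijGroup X)"
  proof (rule B.subgroupI)
    show "?H \<subseteq> carrier (BijGroup X)"
      by (auto simp: BijGroup_def)
    have "(\<lambda>x\<in>X. x) \<in> ?H"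
      by (auto simp: id_Bij)
    then show "?H \<noteq> {}" by blast
  next
    fix f assume f: "f \<in> ?H"
    have "dist (inv_into X f x) (inv_into X f y) = dist x y" if "x \<in> X" "y \<in> X" for x y
    proof -
      have "f ` X = X" using f by (auto simp: Bij_def bij_betw_def)
      then have *: "inv_into X f x \<in> X" "f (inv_into X f x) = x"
          "inv_into X f y \<in> X" "f (inv_into X f y) = y"
        using that by (simp_all add: inv_into_into f_inv_into_f)
      have "dist (f (inv_into X f x)) (f (inv_into X f y)) = dist (inv_into X f x) (inv_into X f y)"
        using f *(1,3) by blast
      then show ?thesis
        by (simp add: *)
    qed
    then show "inv\<^bsub>BijGroup X\<^esub> f \<in> ?H"
      using f by (simp add: inv_BijGroup restrict_inv_into_Bij)
  next
    fix f g assume "f \<in> ?H" "g \<in> ?H"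
    then show "f \<otimes>\<^bsub>BijGroup X\<^esub> g \<in> ?H"
      by (auto simp: BijGroup_def compose_Bij compose_eq funcset_mem[OF Bij_imp_funcset])
  qed
  then show ?thesis
    unfolding isometry_group_def by (rule B.subgroup_imp_group)
qed


section \<open>Great circles, their angles, and reflections\<close>

abbreviation S2 :: "(real^3) set" where
  "S2 \<equiv> sphere 0 1"

definition great_circles :: "(real^3) set set" where
  "great_circles = {V \<inter> S2 |V. subspace V \<and> dim V = 2}"

definition orth_reflection :: "'a::euclidean_space set \<Rightarrow> 'a \<Rightarrow> 'a" where
  "orth_reflection V x = 2 *\<^sub>R closest_point V x - x"

lemma orth_reflection_decomp:
  assumes "subspace V" "v \<in> V" "w \<in> V\<^sup>\<bottom>"
  shows "orth_reflection V (v + w) = v - w"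
proof -
  have "closest_point V (v + w) = v"
  proof (rule closest_point_unique[symmetric])
    show "\<forall>z\<in>V. dist (v + w) v \<le> dist (v + w) z"
    proof
      fix z assume "z \<in> V"
      then have "orthogonal (v - z) w"
        using assms by (auto simp: orthogonal_comp_def subspace_diff)
      then have "(norm (v - z + w))\<^sup>2 = (norm (v - z))\<^sup>2 + (norm w)\<^sup>2"
        by (rule norm_add_Pythagorean)
      then have "(norm w)\<^sup>2 \<le> (norm (v - z + w))\<^sup>2" by simp
      then have "norm w \<le> norm (v - z + w)" by (rule power2_le_imp_le) simp
      then show "dist (v + w) v \<le> dist (v + w) z"
        by (simp add: dist_norm algebra_simps)
    qed
  qed (use assms in \<open>auto simp: subspace_imp_convex closed_subspace\<close>)
  then show ?thesis
    by (simp add: orth_reflection_def scaleR_2)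
qed

text \<open>The 2-dimensional vector subspace containing a great circle is its linear span.\<close>

definition gc_reflection :: "(real^3) set \<Rightarrow> real^3 \<Rightarrow> real^3" where
  "gc_reflection l = restrict (orth_reflection (span l)) S2"

text \<open>The (unoriented) angle, in the interval from \<open>0\<close> to \<open>pi / 2\<close>, between the
  tangent lines of two great circles at a common point \<open>p\<close>. The points \<open>u\<close> of
  a great circle through \<open>p\<close> with \<open>u \<bullet> p = 0\<close> are its two unit tangent vectors at \<open>p\<close>; the value
  depends on none of the choices, see \<open>great_circle_angle_eq\<close> below.\<close>

definition great_circle_angle :: "(real^3) set \<Rightarrow> (real^3) set \<Rightarrow> real" where
  "great_circle_angle l m =
     (THE \<theta>. \<forall>p\<in>l \<inter> m. \<forall>u\<in>l. \<forall>v\<in>m. u \<bullet> p = 0 \<and> v \<bullet> p = 0 \<longrightarrow> \<theta> = arccos \<bar>u \<bullet> v\<bar>)"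

lemma span_great_circle:
  assumes "subspace V"
  shows "span (V \<inter> S2) = V"
proof
  show "span (V \<inter> S2) \<subseteq> V"
    using assms by (simp add: span_minimal)
  show "V \<subseteq> span (V \<inter> S2)"
  proof
    fix x assume x: "x \<in> V"
    show "x \<in> span (V \<inter> S2)"
    proof (cases "x = 0")
      case False
      then have "(1 / norm x) *\<^sub>R x \<in> V \<inter> S2"
        using x assms by (simp add: subspace_scale)
      then have "norm x *\<^sub>R ((1 / norm x) *\<^sub>R x) \<in> span (V \<inter> S2)"
        by (blast intro: span_base span_scale)
      then show ?thesis using False by simp
    qed (simp add: span_zero)
  qed
qed

lemma great_circle_normal:
  assumes "l \<in> great_circles"
  obtains a where "norm a = 1" "l = {x. norm x = 1 \<and> a \<bullet> x = 0}"
proof -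
  obtain V where V: "subspace V" "dim V = 2" "l = V \<inter> S2"
    using assms by (auto simp: great_circles_def)
  have "span V = V"
    using V(1) by simp
  moreover have "\<exists>b. b \<noteq> 0 \<and> span V = {x. b \<bullet> x = 0}"
    using dim_eq_hyperplane[of V] V(2) by simp
  ultimately obtain b where b: "b \<noteq> 0" "V = {x. b \<bullet> x = 0}"
    by metis
  show thesis
    by (rule that[of "(1 / norm b) *\<^sub>R b"]) (use b V in auto)
qed

lemma gc_reflection_in_isometry_group:
  assumes "l \<in> great_circles"
  shows "gc_reflection l \<in> carrier (isometry_group S2)"
proof -
  obtain V where V: "subspace V" "l = V \<inter> S2"
    using assms by (auto simp: great_circles_def)
  let ?r = "orth_reflection V"
  have rl: "gc_reflection l = restrict ?r S2"
    by (simp add: gc_reflection_def V span_great_circle)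
  have decomp: "\<exists>v w. v \<in> V \<and> w \<in> V\<^sup>\<bottom> \<and> x = v + w" for x :: "real^3"
    using subspace_sum_orthogonal_comp[OF V(1)] by (metis UNIV_I set_plus_elim)
  have isom: "dist (?r x) (?r y) = dist x y" for x y
  proof -
    obtain v w v' w' where *: "v \<in> V" "w \<in> V\<^sup>\<bottom>" "x = v + w" "v' \<in> V" "w' \<in> V\<^sup>\<bottom>" "y = v' + w'"
      using decomp by meson
    have "orthogonal (v - v') (w - w')"
      using * V(1) by (auto simp: orthogonal_comp_def subspace_diff orthogonal_clauses)
    then have "norm ((v - v') - (w - w')) = norm ((v - v') + (w - w'))"
      by (simp add: norm_eq orthogonal_def inner_simps inner_commute)
    moreover have "?r x - ?r y = (v - v') - (w - w')" "x - y = (v - v') + (w - w')"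
      using * V(1) by (simp_all add: orth_reflection_decomp)
    ultimately show ?thesis
      by (simp only: dist_norm)
  qed
  have inv: "?r (?r x) = x" for x
  proof -
    obtain v w where *: "v \<in> V" "w \<in> V\<^sup>\<bottom>" "x = v + w"
      using decomp by meson
    then have "- w \<in> V\<^sup>\<bottom>" by (simp add: subspace_neg subspace_orthogonal_comp)
    then show ?thesis
      using * V(1) orth_reflection_decomp[of V v "- w"] by (simp add: orth_reflection_decomp)
  qed
  have "?r 0 = 0"
    using orth_reflection_decomp[of V 0 0] V(1)
    by (simp add: subspace_0 subspace_orthogonal_comp)
  then have "?r x \<in> S2" if "x \<in> S2" for x
    using isom[of 0 x] that by simp
  then have "bij_betw ?r S2 S2"
    by (intro bij_betw_byWitness[where f' = ?r]) (auto simp: inv)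
  then show ?thesis
    using bij_betw_cong[of S2 "restrict ?r S2" ?r S2]
    by (simp add: rl isometry_group_def Bij_def isom del: restrict_apply)
       (simp add: isom)
qed

lemma norm_cross3_unit:
  assumes "norm x = 1" "norm y = 1" "x \<bullet> y = 0"
  shows "norm (cross3 x y) = 1"
proof -
  have "(norm (cross3 x y))\<^sup>2 = 1\<^sup>2"
    using norm_cross_dot[of x y] assms by simp
  then show ?thesis
    by (rule power2_eq_imp_eq) auto
qed

lemma tangent_unique:
  fixes a b p u v :: "real^3"
  assumes "norm a = 1" "norm b = 1" "norm p = 1" "norm u = 1" "norm v = 1"
    and "a \<bullet> p = 0" "b \<bullet> p = 0" "a \<bullet> u = 0" "b \<bullet> v = 0" "u \<bullet> p = 0" "v \<bullet> p = 0"
  shows "\<bar>u \<bullet> v\<bar> = \<bar>a \<bullet> b\<bar>"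
proof -
  have pm: "cross3 w p = n \<or> cross3 w p = - n"
    if "norm n = 1" "norm w = 1" "n \<bullet> p = 0" "n \<bullet> w = 0" "w \<bullet> p = 0" for n w :: "real^3"
  proof -
    let ?c = "cross3 w p"
    have c: "norm ?c = 1"
      using that assms(3) by (simp add: norm_cross3_unit)
    have "cross3 n ?c = 0"
      using Lagrange[of n w p] that by simp
    then have "(n \<bullet> ?c)\<^sup>2 = 1"
      using norm_cross_dot[of n ?c] that c by simp
    then have "n \<bullet> ?c = 1 \<or> n \<bullet> ?c = - 1"
      by (simp add: power2_eq_1_iff)
    moreover have nn: "n \<bullet> n = 1" "?c \<bullet> ?c = 1"
      using that(1) c by (simp_all add: norm_eq_1)
    ultimately have "(?c - n) \<bullet> (?c - n) = 0 \<or> (?c + n) \<bullet> (?c + n) = 0"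
      by (auto simp: inner_simps inner_commute)
    then show ?thesis
      by (auto simp: eq_neg_iff_add_eq_0)
  qed
  have "u \<bullet> v = cross3 u p \<bullet> cross3 v p"
    using assms dot_cross[of u p v p] by (simp add: norm_eq_1 inner_commute)
  moreover have "cross3 u p = a \<or> cross3 u p = - a" "cross3 v p = b \<or> cross3 v p = - b"
    by (rule pm; use assms in simp)+
  ultimately show ?thesis
    by (elim disjE) simp_all
qed

lemma great_circles_meet:
  assumes "l \<in> great_circles" "m \<in> great_circles"
  obtains p u v where "p \<in> l \<inter> m" "u \<in> l" "v \<in> m" "u \<bullet> p = 0" "v \<bullet> p = 0"
proof -
  obtain a where a: "norm a = 1" "l = {x. norm x = 1 \<and> a \<bullet> x = 0}"
    using assms(1) by (rule great_circle_normal)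
  obtain b where b: "norm b = 1" "m = {x. norm x = 1 \<and> b \<bullet> x = 0}"
    using assms(2) by (rule great_circle_normal)
  have "dim {a, b} \<le> card {a, b}"
    by (rule dim_le_card) (auto intro: span_base)
  also have "\<dots> \<le> 2"
    by (simp add: card_insert_if)
  finally have "dim {a, b} < DIM(real^3)" by simp
  then obtain q where q: "q \<noteq> 0" "\<And>y. y \<in> span {a, b} \<Longrightarrow> orthogonal q y"
    using orthogonal_to_subspace_exists by blast
  define p where "p = (1 / norm q) *\<^sub>R q"
  have "orthogonal q a" "orthogonal q b"
    by (auto intro: q(2) span_base)
  then have p: "norm p = 1" "a \<bullet> p = 0" "b \<bullet> p = 0"
    using q(1) by (auto simp: p_def orthogonal_def inner_commute)
  have "norm (cross3 a p) = 1" "norm (cross3 b p) = 1"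
    using a(1) b(1) p by (simp_all add: norm_cross3_unit)
  then show thesis
    using a b p by (intro that[of p "cross3 a p" "cross3 b p"]) (auto simp: dot_cross_self)
qed

lemma great_circle_angle_eq:
  assumes "l \<in> great_circles" "m \<in> great_circles"
    and "p \<in> l \<inter> m" "u \<in> l" "v \<in> m" "u \<bullet> p = 0" "v \<bullet> p = 0"
  shows "great_circle_angle l m = arccos \<bar>u \<bullet> v\<bar>"
proof -
  obtain a where a: "norm a = 1" "l = {x. norm x = 1 \<and> a \<bullet> x = 0}"
    using assms(1) by (rule great_circle_normal)
  obtain b where b: "norm b = 1" "m = {x. norm x = 1 \<and> b \<bullet> x = 0}"
    using assms(2) by (rule great_circle_normal)
  have *: "\<bar>u' \<bullet> v'\<bar> = \<bar>a \<bullet> b\<bar>"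
    if "p' \<in> l \<inter> m" "u' \<in> l" "v' \<in> m" "u' \<bullet> p' = 0" "v' \<bullet> p' = 0" for p' u' v'
    using that a b by (intro tangent_unique[where p = p']) auto
  show ?thesis
    unfolding great_circle_angle_def
  proof (rule the_equality)
    show "\<forall>p'\<in>l \<inter> m. \<forall>u'\<in>l. \<forall>v'\<in>m. u' \<bullet> p' = 0 \<and> v' \<bullet> p' = 0
            \<longrightarrow> arccos \<bar>u \<bullet> v\<bar> = arccos \<bar>u' \<bullet> v'\<bar>"
      using * assms by presburger
  next
    fix \<theta>
    assume "\<forall>p\<in>l \<inter> m. \<forall>u\<in>l. \<forall>v\<in>m. u \<bullet> p = 0 \<and> v \<bullet> p = 0 \<longrightarrow> \<theta> = arccos \<bar>u \<bullet> v\<bar>"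
    then show "\<theta> = arccos \<bar>u \<bullet> v\<bar>"
      using assms(3-7) by metis
  qed
qed


section \<open>Pencil and involution relations\<close>

definition pencil_relation ::
    "(real^3) set \<Rightarrow> (real^3) set \<Rightarrow> (real^3) set \<Rightarrow> (real^3) set \<Rightarrow> bool" where
  "pencil_relation l m l' m' \<longleftrightarrow>
     {l, m, l', m'} \<subseteq> great_circles \<and>
     l \<inter> m = l' \<inter> m' \<and>
     great_circle_angle l m = great_circle_angle l' m' \<and>
     great_circle_angle l l' = great_circle_angle m m' \<and>
     gc_reflection m \<otimes>\<^bsub>isometry_group S2\<^esub> gc_reflection l = gc_reflection m' \<otimes>\<^bsub>isometry_group S2\<^esub> gc_reflection l'"

abbreviation free_refl_group :: "(bool \<times> (real^3) set) list monoid" (\<open>\<F>\<close>) where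
  "\<F> \<equiv> free_group great_circles"

definition involution_relators :: "(bool \<times> (real^3) set) list set" where
  "involution_relators = {free_gen l [^]\<^bsub>\<F>\<^esub> (2::nat) |l. l \<in> great_circles}"

definition pencil_relators :: "(bool \<times> (real^3) set) list set" where
  "pencil_relators =
     {free_gen m \<otimes>\<^bsub>\<F>\<^esub> free_gen l \<otimes>\<^bsub>\<F>\<^esub> inv\<^bsub>\<F>\<^esub> (free_gen m' \<otimes>\<^bsub>\<F>\<^esub> free_gen l') |l m l' m'.
        pencil_relation l m l' m'}"

end

theory Submission
  imports Defs
begin

text \<open>In a pencil of great circles through \<open>p\<close>, any product of two reflections can be rewritten so that
  a prescribed member of the pencil occurs in it. In a word of four reflections, rewrite the first
  and the last pair so that both contain the great circle through a common point of either
  pair; it then cancels, so four letters become two. Every relation thus reduces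
  to one of length two, which says that the two circles agree, or of length
  three. In the latter, a common point of the first two circles is fixed by the third reflection,
  so all three circles lie in a pencil and one more rewriting would give a reflection equal to the identity.\<close>

section \<open>Great circles and their unit normals\<close>

text \<open>For a unit vector \<open>a\<close> this is the great circle with unit normals
  \<open>a\<close> and \<open>- a\<close>. Incidence, angle and reflection then become statements
  about inner products of normals.\<close>

definition normal_circle :: "real^3 \<Rightarrow> (real^3) set" where
  "normal_circle a = {x. norm x = 1 \<and> a \<bullet> x = 0}"

lemma normal_circle_eq_Int: "normal_circle a = {x. a \<bullet> x = 0} \<inter> S2"
  by (auto simp: normal_circle_def)

lemma normal_circle_uminus [simp]: "normal_circle (- a) = normal_circle a"
  by (simp add: normal_circle_def)

lemma normal_circle_in_great_circles [simp]:
  assumes "norm a = 1"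
  shows "normal_circle a \<in> great_circles"
proof -
  have "dim {x. a \<bullet> x = 0} = 2"
    using assms dim_hyperplane[of a] by force
  then show ?thesis
    unfolding great_circles_def normal_circle_eq_Int
    using subspace_hyperplane[of a] by blast
qed

lemma great_circlesE:
  assumes "l \<in> great_circles"
  obtains a where "norm a = 1" "l = normal_circle a"
  using great_circle_normal[OF assms] unfolding normal_circle_def by metis

text \<open>At a common point \<open>p\<close>, a quarter turn about \<open>p\<close> carries the
  unit tangents to the unit normals up to sign, so tangents and normals enclose the same unoriented
  angle.\<close>

lemma great_circle_angle_normal_circle:
  assumes "norm a = 1" "norm b = 1"
  shows "great_circle_angle (normal_circle a) (normal_circle b) = arccos \<bar>a \<bullet> b\<bar>"
proof -
  have gc: "normal_circle a \<in> great_circles" "normal_circle b \<in> great_circles"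
    using assms by auto
  then obtain p u v where *: "p \<in> normal_circle a \<inter> normal_circle b" "u \<in> normal_circle a"
      "v \<in> normal_circle b" "u \<bullet> p = 0" "v \<bullet> p = 0"
    by (rule great_circles_meet)
  then have "\<bar>u \<bullet> v\<bar> = \<bar>a \<bullet> b\<bar>"
    using assms by (intro tangent_unique[where p = p]) (auto simp: normal_circle_def)
  then show ?thesis
    using great_circle_angle_eq[OF gc *] by simp
qed

lemma gc_reflection_normal_circle:
  assumes "norm a = 1"
  shows "gc_reflection (normal_circle a) = (\<lambda>x\<in>S2. x - (2 * (a \<bullet> x)) *\<^sub>R a)"
proof -
  let ?V = "{x. a \<bullet> x = 0}"
  have V: "subspace ?V"
    by (rule subspace_hyperplane)
  \<comment> \<open>Split \<open>x\<close> into its projection to the plane and its normal component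
    \<open>(a \<bullet> x) *\<^sub>R a\<close>, whose sign is reversed.\<close>
  have "orth_reflection ?V x = x - (2 * (a \<bullet> x)) *\<^sub>R a" for x
  proof -
    have "a \<bullet> a = 1"
      using assms by (simp add: norm_eq_1)
    then have "x - (a \<bullet> x) *\<^sub>R a \<in> ?V"
      by (simp add: inner_diff_right)
    moreover have "(a \<bullet> x) *\<^sub>R a \<in> ?V\<^sup>\<bottom>"
      by (auto simp: orthogonal_comp_def orthogonal_def inner_commute)
    ultimately show ?thesis
      using orth_reflection_decomp[OF V, of "x - (a \<bullet> x) *\<^sub>R a" "(a \<bullet> x) *\<^sub>R a"]
      by (simp add: algebra_simps flip: scaleR_2)
  qed
  then show ?thesis
    by (auto simp: gc_reflection_def normal_circle_eq_Int span_great_circle[OF V] fun_eq_iff restrict_def)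
qed

lemma gc_reflection_fixed_iff:
  assumes "l \<in> great_circles" "x \<in> S2"
  shows "gc_reflection l x = x \<longleftrightarrow> x \<in> l"
proof -
  obtain a where a: "norm a = 1" "l = normal_circle a"
    using assms(1) by (rule great_circlesE)
  moreover have "a \<noteq> 0"
    using a by auto
  ultimately show ?thesis
    using assms(2) by (simp add: gc_reflection_normal_circle) (auto simp: normal_circle_def)
qed

lemma great_circle_subset_S2: "l \<in> great_circles \<Longrightarrow> l \<subseteq> S2"
  by (auto simp: great_circles_def)

text \<open>Duality of points and circles: a common point \<open>a\<close> of the circles with
  normals \<open>p\<close> and \<open>q\<close> is itself normal to a circle through both. This also
  covers \<open>p = q\<close> and \<open>p = - q\<close>.\<close>

lemma great_circle_through:
  assumes "p \<in> S2" "q \<in> S2"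
  obtains m where "m \<in> great_circles" "p \<in> m" "q \<in> m"
proof -
  have "norm p = 1" "norm q = 1"
    using assms by auto
  then obtain a where "a \<in> normal_circle p \<inter> normal_circle q"
    using great_circles_meet[of "normal_circle p" "normal_circle q"] by auto
  then have "norm a = 1" "p \<in> normal_circle a" "q \<in> normal_circle a"
    using assms by (auto simp: normal_circle_def inner_commute)
  then show thesis
    by (intro that[of "normal_circle a"]) auto
qed


section \<open>Pencils and the isometry group\<close>

lemma mult_isometry_group:
  assumes "f \<in> carrier (isometry_group X)" "g \<in> carrier (isometry_group X)"
  shows "f \<otimes>\<^bsub>isometry_group X\<^esub> g = compose X f g"
  using assms by (simp add: isometry_group_def BijGroup_def)

lemma one_isometry_group: "\<one>\<^bsub>isometry_group X\<^esub> = (\<lambda>x\<in>X. x)"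
  by (simp add: isometry_group_def BijGroup_def)

lemma gc_reflection_in_S2:
  assumes "l \<in> great_circles" "x \<in> S2"
  shows "gc_reflection l x \<in> S2"
proof (rule funcset_mem[OF Bij_imp_funcset assms(2)])
  show "gc_reflection l \<in> Bij S2"
    using gc_reflection_in_isometry_group[OF assms(1)] by (simp add: isometry_group_def)
qed

lemma gc_reflection_mult_apply:
  assumes "l \<in> great_circles" "m \<in> great_circles" "x \<in> S2"
  shows "(gc_reflection l \<otimes>\<^bsub>isometry_group S2\<^esub> gc_reflection m) x = gc_reflection l (gc_reflection m x)"
  using assms by (simp add: mult_isometry_group gc_reflection_in_isometry_group compose_eq)

lemma gc_reflection_mult_self:
  assumes "l \<in> great_circles"
  shows "gc_reflection l \<otimes>\<^bsub>isometry_group S2\<^esub> gc_reflection l = \<one>\<^bsub>isometry_group S2\<^esub>"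
proof -
  obtain a where a: "norm a = 1" "l = normal_circle a"
    using assms by (rule great_circlesE)
  then have "a \<bullet> a = 1"
    by (simp add: norm_eq_1)
  have "gc_reflection l (gc_reflection l x) = x" if "x \<in> S2" for x
    using that gc_reflection_in_S2[OF assms that] a \<open>a \<bullet> a = 1\<close>
    by (simp add: gc_reflection_normal_circle algebra_simps)
  then show ?thesis
    using assms
    by (auto simp: mult_isometry_group gc_reflection_in_isometry_group one_isometry_group compose_def fun_eq_iff)
qed

lemma gc_reflection_neq_one:
  assumes "l \<in> great_circles"
  shows "gc_reflection l \<noteq> \<one>\<^bsub>isometry_group S2\<^esub>"
proof
  obtain a where a: "norm a = 1" "l = normal_circle a"
    using assms by (rule great_circlesE)
  then have "a \<in> S2" "a \<notin> l"
    by (auto simp: normal_circle_def)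
  moreover assume "gc_reflection l = \<one>\<^bsub>isometry_group S2\<^esub>"
  ultimately show False
    using gc_reflection_fixed_iff[OF assms, of a] by (simp add: one_isometry_group)
qed

text \<open>A great circle is recovered from its reflection as the set of fixed points.\<close>

lemma gc_reflection_inj:
  assumes "l \<in> great_circles" "m \<in> great_circles" "gc_reflection l = gc_reflection m"
  shows "l = m"
proof -
  have fix_set: "k = {x \<in> S2. gc_reflection k x = x}" if "k \<in> great_circles" for k
    using gc_reflection_fixed_iff[OF that] great_circle_subset_S2[OF that] by auto
  show ?thesis
    using fix_set[OF assms(1)] fix_set[OF assms(2)] assms(3) by simp
qed

text \<open>The normal \<open>a'\<close> of the fourth circle is the quaternion product \<open>a b\<^sup>-\<^sup>1 c\<close>, which for coplanar
  unit vectors is \<open>(a \<bullet> b) c + (c \<bullet> b) a - (c \<bullet> a) b\<close>.\<close>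

lemma pencil_relation_normal_circle:
  assumes n: "norm a = 1" "norm b = 1" "norm c = 1" and c: "c = s *\<^sub>R a + t *\<^sub>R b"
  defines "a' \<equiv> (2 * s * (a \<bullet> b) + t) *\<^sub>R a - s *\<^sub>R b"
  shows "norm a' = 1"
    and "pencil_relation (normal_circle b) (normal_circle a) (normal_circle c) (normal_circle a')"
proof -
  define x where "x = a \<bullet> b"
  have ip: "a \<bullet> a = 1" "b \<bullet> b = 1" "a \<bullet> b = x" "b \<bullet> a = x" "c \<bullet> c = 1"
    using n by (simp_all add: norm_eq_1 x_def inner_commute)
  have a': "a' = (2 * s * x + t) *\<^sub>R a - s *\<^sub>R b"
    by (simp add: a'_def x_def)
  \<comment> \<open>The unit length of \<open>c\<close> in coordinates; the identities below that
    need more than expansion hold modulo this one.\<close>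
  have st: "s * s + t * t + 2 * s * t * x = 1"
    using ip(5) by (simp add: c inner_simps ip algebra_simps)
  have "a' \<bullet> a' = 1"
    unfolding a' by (simp add: inner_simps ip) (use st in algebra)
  then show na': "norm a' = 1"
    by (simp add: norm_eq_1)
  \<comment> \<open>This and \<open>a'a\<close> supply the two angle conditions, as equalities of
    inner products of normals.\<close>
  have "a' \<bullet> c = x * (s * s + t * t + 2 * s * t * x)"
    unfolding a' c by (simp add: inner_simps ip) algebra
  then have a'c: "c \<bullet> a' = b \<bullet> a"
    by (simp add: st ip inner_commute)
  have a'a: "b \<bullet> c = a \<bullet> a'"
    unfolding a' c by (simp add: inner_simps ip)
  \<comment> \<open>The matrix taking \<open>(a, b)\<close> to \<open>(c, a')\<close> has rows
    \<open>(s, t)\<close> and \<open>(2 * s * x + t, - s)\<close>. By \<open>st\<close> it is its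
    own inverse, so the same coefficients lead back. Hence both pairs of normals have the same
    orthogonal complement.\<close>
  have "a = (s * s + t * t + 2 * s * t * x) *\<^sub>R a" "b = (s * s + t * t + 2 * s * t * x) *\<^sub>R b"
    by (simp_all add: st)
  then have ab: "a = s *\<^sub>R c + t *\<^sub>R a'" "b = (2 * s * x + t) *\<^sub>R c - s *\<^sub>R a'"
    unfolding c a' by (simp_all add: algebra_simps)
  have "a \<bullet> y = 0 \<and> b \<bullet> y = 0 \<longleftrightarrow> c \<bullet> y = 0 \<and> a' \<bullet> y = 0" for y
  proof
    assume "a \<bullet> y = 0 \<and> b \<bullet> y = 0"
    then show "c \<bullet> y = 0 \<and> a' \<bullet> y = 0"
      unfolding c a' by (simp add: inner_simps)
  next
    assume *: "c \<bullet> y = 0 \<and> a' \<bullet> y = 0"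
    have "a \<bullet> y = s * (c \<bullet> y) + t * (a' \<bullet> y)" "b \<bullet> y = (2 * s * x + t) * (c \<bullet> y) - s * (a' \<bullet> y)"
      by (subst ab, simp add: inner_simps)+
    with * show "a \<bullet> y = 0 \<and> b \<bullet> y = 0"
      by simp
  qed
  then have inter: "normal_circle b \<inter> normal_circle a = normal_circle c \<inter> normal_circle a'"
    by (auto simp: normal_circle_def)
  have comp: "gc_reflection (normal_circle a) (gc_reflection (normal_circle b) y)
      = gc_reflection (normal_circle a') (gc_reflection (normal_circle c) y)"
    if "y \<in> S2" for y
  proof -
    define A B where "A = a \<bullet> y" and "B = b \<bullet> y"
    define r where "r = 2 * s * x + t"
    have cy: "c \<bullet> y = s * A + t * B" "a' \<bullet> y = r * A - s * B"
      unfolding c a' A_def B_def r_def by (simp_all add: inner_simps)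
    have a'c_x: "a' \<bullet> c = x"
      using a'c by (simp add: ip inner_commute)
    have rst: "s * s + t * r = 1"
      using st by (simp add: r_def algebra_simps)
    \<comment> \<open>Both compositions add to \<open>y\<close> a combination of \<open>a\<close>
      and \<open>b\<close>. The coefficients of \<open>b\<close> are compared here, those of
      \<open>a\<close> next.\<close>
    have "- 2 * B = - 2 * (s * A + t * B) * t - (2 * (r * A - s * B) - 4 * (s * A + t * B) * x) * (- s)"
      using st unfolding r_def by algebra
    moreover have "- 2 * A + 4 * B * x
        = - 2 * (s * A + t * B) * s - (2 * (r * A - s * B) - 4 * (s * A + t * B) * x) * r"
      using st unfolding r_def by algebra
    moreover have "y - (2 * (b \<bullet> y)) *\<^sub>R b - (2 * (a \<bullet> (y - (2 * (b \<bullet> y)) *\<^sub>R b))) *\<^sub>R a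
        = y + (- 2 * B) *\<^sub>R b + (- 2 * A + 4 * B * x) *\<^sub>R a"
      by (simp add: inner_simps ip algebra_simps flip: A_def B_def)
    moreover have "y - (2 * (c \<bullet> y)) *\<^sub>R c - (2 * (a' \<bullet> (y - (2 * (c \<bullet> y)) *\<^sub>R c))) *\<^sub>R a'
        = y + (- 2 * (s * A + t * B) * t - (2 * (r * A - s * B) - 4 * (s * A + t * B) * x) * (- s)) *\<^sub>R b
          + (- 2 * (s * A + t * B) * s - (2 * (r * A - s * B) - 4 * (s * A + t * B) * x) * r) *\<^sub>R a"
      unfolding inner_diff_right inner_scaleR_right a'c_x cy
      unfolding c a' r_def by (simp add: algebra_simps)
    ultimately have "y - (2 * (b \<bullet> y)) *\<^sub>R b - (2 * (a \<bullet> (y - (2 * (b \<bullet> y)) *\<^sub>R b))) *\<^sub>R a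
        = y - (2 * (c \<bullet> y)) *\<^sub>R c - (2 * (a' \<bullet> (y - (2 * (c \<bullet> y)) *\<^sub>R c))) *\<^sub>R a'"
      by metis
    then show ?thesis
      using that n na' gc_reflection_in_S2[of "normal_circle b" y] gc_reflection_in_S2[of "normal_circle c" y]
      by (simp add: gc_reflection_normal_circle)
  qed
  show "pencil_relation (normal_circle b) (normal_circle a) (normal_circle c) (normal_circle a')"
    unfolding pencil_relation_def
  proof (intro conjI)
    show "gc_reflection (normal_circle a) \<otimes>\<^bsub>isometry_group S2\<^esub> gc_reflection (normal_circle b)
        = gc_reflection (normal_circle a') \<otimes>\<^bsub>isometry_group S2\<^esub> gc_reflection (normal_circle c)"
      using n na' comp by (simp add: mult_isometry_group gc_reflection_in_isometry_group compose_def fun_eq_iff)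
  qed (use n na' inter a'c a'a in \<open>auto simp: great_circle_angle_normal_circle\<close>)
qed

text \<open>The normals of two different circles through \<open>p\<close> are independent, hence
  span the plane orthogonal to \<open>p\<close>. The normal of any third circle through
  \<open>p\<close> is therefore a combination of them.\<close>

lemma pencil_relation_exists:
  assumes "l \<in> great_circles" "m \<in> great_circles" "k \<in> great_circles"
    and p: "p \<in> l" "p \<in> m" "p \<in> k" and "l \<noteq> m"
  obtains k' where "k' \<in> great_circles" "pencil_relation l m k k'"
proof -
  obtain a b c where n: "norm a = 1" "norm b = 1" "norm c = 1"
    and gc: "m = normal_circle a" "l = normal_circle b" "k = normal_circle c"
    using assms(1-3) by (metis great_circlesE)
  have "b \<noteq> 0" "p \<noteq> 0"
    using n p gc by (auto simp: normal_circle_def)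
  have "a \<notin> span {b}"
  proof
    assume "a \<in> span {b}"
    then obtain r where r: "a = r *\<^sub>R b"
      by (auto simp: span_singleton)
    then have "r = 1 \<or> r = - 1"
      using n by simp linarith
    then show False
      using \<open>l \<noteq> m\<close> r gc by auto
  qed
  then have "a \<noteq> b" "independent {a, b}"
    using \<open>b \<noteq> 0\<close> by (auto simp: independent_insert span_base)
  then have "dim (span {a, b}) = 2"
    by (simp add: dim_eq_card_independent)
  moreover have "dim {x. p \<bullet> x = 0} = 2"
    using dim_hyperplane[OF \<open>p \<noteq> 0\<close>] by simp
  moreover have "span {a, b} \<subseteq> {x. p \<bullet> x = 0}"
    using p gc by (intro span_minimal subspace_hyperplane) (auto simp: normal_circle_def inner_commute)
  ultimately have "span {a, b} = {x. p \<bullet> x = 0}"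
    by (intro subspace_dim_equal subspace_span subspace_hyperplane) auto
  moreover have "p \<bullet> c = 0"
    using p gc by (simp add: normal_circle_def inner_commute)
  ultimately have "c \<in> span {a, b}"
    by auto
  then obtain s t where "c = s *\<^sub>R a + t *\<^sub>R b"
    by (auto simp: span_insert span_singleton algebra_simps)
  note * = pencil_relation_normal_circle[OF n this]
  show thesis
    using that[OF normal_circle_in_great_circles[OF *(1)]] *(2) gc by blast
qed


section \<open>Reducing words in a group satisfying the relations\<close>

text \<open>Only the relations usable for rewriting are assumed, so that one reduction serves the
  isometry group, the quotients of the free group and products of the two.\<close>

locale gc_relations = group G for G (structure) +
  fixes g :: "(real^3) set \<Rightarrow> 'a"
  assumes g_closed [simp]: "l \<in> great_circles \<Longrightarrow> g l \<in> carrier G"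
    and g_involution: "l \<in> great_circles \<Longrightarrow> g l \<otimes> g l = \<one>"
    and g_pencil: "pencil_relation l m l' m' \<Longrightarrow> g m \<otimes> g l = g m' \<otimes> g l'"
begin

lemma g_inv: "l \<in> great_circles \<Longrightarrow> inv (g l) = g l"
  by (simp add: g_involution inv_equality)

lemma g_cancel: "l \<in> great_circles \<Longrightarrow> x \<in> carrier G \<Longrightarrow> g l \<otimes> (g l \<otimes> x) = x"
  by (simp add: g_involution flip: m_assoc)

lemma rewrite_right:
  assumes "l \<in> great_circles" "m \<in> great_circles" "k \<in> great_circles"
    and "p \<in> l" "p \<in> m" "p \<in> k" "l \<noteq> m"
  obtains k' where "k' \<in> great_circles" "g l \<otimes> g m = g k' \<otimes> g k"
  using pencil_relation_exists[of m l k p] g_pencil assms by metis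

text \<open>The inverse of \<open>rewrite_right\<close> for the reversed pair, each generator being
  its own inverse.\<close>

lemma rewrite_left:
  assumes "l \<in> great_circles" "m \<in> great_circles" "k \<in> great_circles"
    and "p \<in> l" "p \<in> m" "p \<in> k" "l \<noteq> m"
  obtains k' where "k' \<in> great_circles" "g l \<otimes> g m = g k \<otimes> g k'"
proof -
  obtain k' where k': "k' \<in> great_circles" "g m \<otimes> g l = g k' \<otimes> g k"
    using rewrite_right[of m l k p] assms by metis
  have "g l \<otimes> g m = inv (g m \<otimes> g l)"
    using assms by (simp add: inv_mult_group g_inv)
  also have "\<dots> = g k \<otimes> g k'"
    unfolding k'(2) using k'(1) assms by (simp add: inv_mult_group g_inv)
  finally show thesis
    using that k' by blast
qed

lemma four_to_two:
  assumes gc: "a \<in> great_circles" "b \<in> great_circles" "c \<in> great_circles" "d \<in> great_circles"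
  obtains e f where "e \<in> great_circles" "f \<in> great_circles"
    "g a \<otimes> (g b \<otimes> (g c \<otimes> g d)) = g e \<otimes> g f"
\<comment> \<open>The rewriting lemmas need two different circles; equal neighbours simply
  cancel.\<close>
proof (cases "a = b \<or> c = d")
  case True
  then show thesis
    using that gc by (metis g_cancel g_closed g_involution m_closed r_one)
next
  case False
  obtain p where p: "p \<in> a" "p \<in> b"
    using great_circles_meet[OF gc(1,2)] by auto
  obtain q where q: "q \<in> c" "q \<in> d"
    using great_circles_meet[OF gc(3,4)] by auto
  have "p \<in> S2" "q \<in> S2"
    using great_circle_subset_S2[OF gc(1)] great_circle_subset_S2[OF gc(3)] p q by auto
  then obtain k where k: "k \<in> great_circles" "p \<in> k" "q \<in> k"
    by (rule great_circle_through)
  obtain e where e: "e \<in> great_circles" "g a \<otimes> g b = g e \<otimes> g k"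
    using rewrite_right[of a b k p] gc p k False by metis
  obtain f where f: "f \<in> great_circles" "g c \<otimes> g d = g k \<otimes> g f"
    using rewrite_left[of c d k q] gc q k False by metis
  have "g a \<otimes> (g b \<otimes> (g c \<otimes> g d)) = (g a \<otimes> g b) \<otimes> (g c \<otimes> g d)"
    using gc by (simp add: m_assoc)
  also have "\<dots> = g e \<otimes> g f"
    using e f k by (simp add: m_assoc g_cancel)
  finally show thesis
    using that e f by blast
qed

text \<open>Nested to the right and ending in the unit, as the words in the theorem are.\<close>

definition word_prod :: "(real^3) set list \<Rightarrow> 'a" where
  "word_prod ls = foldr (\<otimes>) (map g ls) \<one>"

lemma word_prod_Nil [simp]: "word_prod [] = \<one>"
  and word_prod_Cons [simp]: "word_prod (l # ls) = g l \<otimes> word_prod ls"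
  by (simp_all add: word_prod_def)

text \<open>Induction by two letters: these and the two to which the tail reduces form a word for
  \<open>four_to_two\<close>.\<close>

lemma even_word_prod:
  assumes "even (length ls)" "set ls \<subseteq> great_circles"
  obtains a b where "a \<in> great_circles" "b \<in> great_circles" "word_prod ls = g a \<otimes> g b"
  using assms
proof (induction ls arbitrary: thesis rule: induct_list012)
  case 1
  \<comment> \<open>The empty word needs some circle; its generator squared is the unit.\<close>
  have "normal_circle (axis 1 1) \<in> great_circles"
    by simp
  then show ?case
    using 1(1) by (metis g_involution word_prod_Nil)
next
  case (3 l m ls)
  obtain c d where cd: "c \<in> great_circles" "d \<in> great_circles" "word_prod ls = g c \<otimes> g d"
    using "3.IH"(1) "3.prems" by auto
  obtain e f where "e \<in> great_circles" "f \<in> great_circles"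
      "g l \<otimes> (g m \<otimes> (g c \<otimes> g d)) = g e \<otimes> g f"
    using four_to_two[of l m c d] "3.prems"(3) cd by auto
  then show ?case
    using "3.prems"(1) cd by simp
qed auto

end

section \<open>Short relations in the isometry group and their transfer to other groups\<close>

interpretation isom: gc_relations "isometry_group S2" gc_reflection
proof -
  interpret group "isometry_group S2"
    by (rule group_isometry_group)
  show "gc_relations (isometry_group S2) gc_reflection"
    by unfold_locales
      (auto simp: gc_reflection_in_isometry_group gc_reflection_mult_self pencil_relation_def)
qed

lemma three_gc_reflections_neq_one:
  assumes gc: "a \<in> great_circles" "b \<in> great_circles" "c \<in> great_circles"
  shows "gc_reflection a \<otimes>\<^bsub>isometry_group S2\<^esub> (gc_reflection b \<otimes>\<^bsub>isometry_group S2\<^esub> gc_reflection c)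
    \<noteq> \<one>\<^bsub>isometry_group S2\<^esub>"
proof
  assume *: "gc_reflection a \<otimes>\<^bsub>isometry_group S2\<^esub> (gc_reflection b \<otimes>\<^bsub>isometry_group S2\<^esub> gc_reflection c)
    = \<one>\<^bsub>isometry_group S2\<^esub>"
  show False
  proof (cases "b = c")
    case True
    then show False
      using * gc by (simp add: isom.g_involution gc_reflection_neq_one)
  next
    case False
    obtain p where p: "p \<in> b" "p \<in> c"
      using great_circles_meet[OF gc(2,3)] by auto
    then have "p \<in> S2"
      using gc great_circle_subset_S2 by blast
    have bc: "gc_reflection a = gc_reflection b \<otimes>\<^bsub>isometry_group S2\<^esub> gc_reflection c"
      using * gc by (metis isom.g_closed isom.g_inv isom.inv_equality isom.inv_inv isom.m_closed)
    then have "gc_reflection a p = gc_reflection b (gc_reflection c p)"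
      using gc \<open>p \<in> S2\<close> by (simp add: gc_reflection_mult_apply)
    also have "\<dots> = p"
      using gc p \<open>p \<in> S2\<close> gc_reflection_fixed_iff by metis
    finally have "p \<in> a"
      using gc \<open>p \<in> S2\<close> by (simp add: gc_reflection_fixed_iff)
    then obtain k' where k': "k' \<in> great_circles"
        "gc_reflection b \<otimes>\<^bsub>isometry_group S2\<^esub> gc_reflection c
          = gc_reflection a \<otimes>\<^bsub>isometry_group S2\<^esub> gc_reflection k'"
      using isom.rewrite_left[of b c a p] gc p False by metis
    \<comment> \<open>By \<open>bc\<close> the right-hand side of the rewriting equals
      \<open>gc_reflection a\<close>, which cancels.\<close>
    then have "gc_reflection k' = \<one>\<^bsub>isometry_group S2\<^esub>"
      using bc gc isom.r_cancel_one' isom.l_cancel_one' isom.g_closed by metis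
    then show False
      using k' gc_reflection_neq_one by blast
  qed
qed

text \<open>The reduction is carried out in the product of \<open>G\<close> with the isometry group, so that it
  yields the same reduced word in both factors.\<close>

lemma (in gc_relations) word_prod_eq_one:
  assumes ls: "set ls \<subseteq> great_circles"
    and one: "isom.word_prod ls = \<one>\<^bsub>isometry_group S2\<^esub>"
  shows "word_prod ls = \<one>"
proof -
  let ?h = "\<lambda>l. (g l, gc_reflection l)"
  interpret P: group "G \<times>\<times> isometry_group S2"
    by (intro DirProd_group is_group group_isometry_group)
  interpret P: gc_relations "G \<times>\<times> isometry_group S2" ?h
    by unfold_locales (auto simp: g_involution isom.g_involution g_pencil isom.g_pencil)
  have prod: "P.word_prod xs = (word_prod xs, isom.word_prod xs)" for xs
    by (induction xs) auto
  show ?thesis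
  proof (cases "even (length ls)")
    case True
    then obtain a b where ab: "a \<in> great_circles" "b \<in> great_circles"
        "P.word_prod ls = ?h a \<otimes>\<^bsub>G \<times>\<times> isometry_group S2\<^esub> ?h b"
      using P.even_word_prod ls by blast
    then have "gc_reflection a \<otimes>\<^bsub>isometry_group S2\<^esub> gc_reflection b = \<one>\<^bsub>isometry_group S2\<^esub>"
      using one prod by simp
    then have "inv\<^bsub>isometry_group S2\<^esub> gc_reflection b = gc_reflection a"
      using ab by (intro isom.inv_equality) auto
    then have "gc_reflection a = gc_reflection b"
      using ab by (simp add: isom.g_inv)
    \<comment> \<open>The circles themselves agree, not only their reflections; this is what carries
      over to \<open>G\<close>, where the word becomes \<open>g a \<otimes> g a\<close>.\<close>
    then have "a = b"
      using ab gc_reflection_inj by blast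
    then show ?thesis
      using ab prod by (simp add: g_involution)
  next
    \<comment> \<open>An odd word is one letter times an even word, thus reduces to three letters
      and cannot be the identity in the isometry group.\<close>
    case False
    then obtain l ls' where l: "ls = l # ls'"
      by (cases ls) auto
    then have "even (length ls')"
      using False by simp
    then obtain a b where ab: "a \<in> great_circles" "b \<in> great_circles"
        "isom.word_prod ls' = gc_reflection a \<otimes>\<^bsub>isometry_group S2\<^esub> gc_reflection b"
      using isom.even_word_prod ls l by (metis set_subset_Cons subset_trans)
    then show ?thesis
      using three_gc_reflections_neq_one[of l a b] ls one l by simp
  qed
qed

section \<open>Quotients of the free group by normal subgroups containing the relators\<close>

theorem theorem3:
  fixes ls :: "(real^3) set list"
  assumes "set ls \<subseteq> great_circles"
    and "foldr (\<otimes>\<^bsub>isometry_group S2\<^esub>) (map gc_reflection ls) \<one>\<^bsub>isometry_group S2\<^esub>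
         = \<one>\<^bsub>isometry_group S2\<^esub>"
  shows "foldr (\<otimes>\<^bsub>\<F>\<^esub>) (map free_gen ls) \<one>\<^bsub>\<F>\<^esub>
         \<in> normal_closure \<F> (involution_relators \<union> pencil_relators)"
  unfolding normal_closure_def
proof (rule InterI)
  fix N assume "N \<in> {N. N \<lhd> \<F> \<and> involution_relators \<union> pencil_relators \<subseteq> N}"
  then have N: "N \<lhd> \<F>" and sub: "involution_relators \<union> pencil_relators \<subseteq> N"
    by auto
  interpret F: group \<F>
    by (rule group_free_group)
  interpret N: normal N \<F>
    by (rule N)
  interpret Q: group "\<F> Mod N"
    by (rule N.factorgroup_is_group)
  let ?q = "\<lambda>w. N #>\<^bsub>\<F>\<^esub> w"
  interpret q: group_hom \<F> "\<F> Mod N" ?q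
    by (intro group_hom.intro group_hom_axioms.intro F.is_group Q.is_group N.r_coset_hom_Mod)
  have one_iff: "?q w = \<one>\<^bsub>\<F> Mod N\<^esub> \<longleftrightarrow> w \<in> N" if "w \<in> carrier \<F>" for w
    using F.coset_join1[OF _ that N.is_subgroup] F.coset_join2[OF that N.is_subgroup]
    by (auto simp: FactGroup_def)
  have gen: "free_gen l \<in> carrier \<F>" if "l \<in> great_circles" for l
    using that by (rule free_gen_in_carrier)
  interpret R: gc_relations "\<F> Mod N" "\<lambda>l. ?q (free_gen l)"
  proof
    fix l :: "(real^3) set" assume l: "l \<in> great_circles"
    then show "?q (free_gen l) \<in> carrier (\<F> Mod N)"
      using gen by simp
    have "free_gen l [^]\<^bsub>\<F>\<^esub> (2::nat) \<in> N"
      using sub l unfolding involution_relators_def by blast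
    then have "free_gen l \<otimes>\<^bsub>\<F>\<^esub> free_gen l \<in> N"
      using gen[OF l] by (simp add: numeral_2_eq_2)
    then show "?q (free_gen l) \<otimes>\<^bsub>\<F> Mod N\<^esub> ?q (free_gen l) = \<one>\<^bsub>\<F> Mod N\<^esub>"
      using gen[OF l] one_iff q.hom_mult by (metis F.m_closed)
  next
    fix l m l' m' assume pr: "pencil_relation l m l' m'"
    then have gc: "free_gen l \<in> carrier \<F>" "free_gen m \<in> carrier \<F>"
        "free_gen l' \<in> carrier \<F>" "free_gen m' \<in> carrier \<F>"
      by (auto simp: pencil_relation_def gen)
    let ?v = "free_gen m \<otimes>\<^bsub>\<F>\<^esub> free_gen l" and ?w = "free_gen m' \<otimes>\<^bsub>\<F>\<^esub> free_gen l'"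
    have "?v \<otimes>\<^bsub>\<F>\<^esub> inv\<^bsub>\<F>\<^esub> ?w \<in> N"
      using sub pr unfolding pencil_relators_def by blast
    then have "?q (?v \<otimes>\<^bsub>\<F>\<^esub> inv\<^bsub>\<F>\<^esub> ?w) = \<one>\<^bsub>\<F> Mod N\<^esub>"
      using gc by (subst one_iff) (auto intro!: F.m_closed F.inv_closed)
    moreover have v: "?v \<in> carrier \<F>" and w: "?w \<in> carrier \<F>"
      using gc by (auto intro!: F.m_closed)
    ultimately have "?q ?v \<otimes>\<^bsub>\<F> Mod N\<^esub> inv\<^bsub>\<F> Mod N\<^esub> ?q ?w = \<one>\<^bsub>\<F> Mod N\<^esub>"
      by (metis F.inv_closed q.hom_inv q.hom_mult)
    then have "?q ?v = ?q ?w"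
      using q.hom_closed[OF v] q.hom_closed[OF w] by (metis Q.inv_closed Q.inv_equality Q.inv_inv)
    then show "?q (free_gen m) \<otimes>\<^bsub>\<F> Mod N\<^esub> ?q (free_gen l) = ?q (free_gen m') \<otimes>\<^bsub>\<F> Mod N\<^esub> ?q (free_gen l')"
      using gc by simp
  qed
  \<comment> \<open>Membership in the carrier is proved along with the equation, since
    multiplicativity of \<open>?q\<close> requires it.\<close>
  have *: "foldr (\<otimes>\<^bsub>\<F>\<^esub>) (map free_gen xs) \<one>\<^bsub>\<F>\<^esub> \<in> carrier \<F> \<and>
      ?q (foldr (\<otimes>\<^bsub>\<F>\<^esub>) (map free_gen xs) \<one>\<^bsub>\<F>\<^esub>) = R.word_prod xs"
    if "set xs \<subseteq> great_circles" for xs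
    using that by (induction xs) (auto simp: gen)
  have "R.word_prod ls = \<one>\<^bsub>\<F> Mod N\<^esub>"
    using assms by (intro R.word_prod_eq_one) (auto simp: isom.word_prod_def)
  then show "foldr (\<otimes>\<^bsub>\<F>\<^esub>) (map free_gen ls) \<one>\<^bsub>\<F>\<^esub> \<in> N"
    using *[OF assms(1)] one_iff by metis
qed

end
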